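(* Let $\mathfrak{A}$ be a residuated lattice, $F$ a filter of $\mathfrak{A}$ and $P$ a prime filter of $\mathfrak{A}$. Then \[D_{F}(P)=\bigcap\{\mathfrak{m}\mid \mathfrak{m}\in Min_{F}(\mathfrak{A}),\ \mathfrak{m}\subseteq P\}.\]
   Context: A residuated lattice is an algebra $\mathfrak{A}=(A;\vee,\wedge,\odot,\rightarrow,0,1)$ such that $(A;\vee,\wedge,0,1)$ is a bounded lattice, $(A;\odot,1)$ is a commutative monoid, and $x\odot y\leq z$ iff $x\leq y\rightarrow z$ for all $x,y,z\in A$. A filter of $\mathfrak{A}$ is a non-empty subset $F\subseteq A$ such that $x,y\in F$ implies $x\odot y\in F$, and $x\in F$, $y\in A$ implies $x\vee y\in F$; it is proper if $F\neq A$. A proper filter $P$ is prime if $x\vee y\in P$ implies $x\in P$ or $y\in P$. $Min_F(\mathfrak{A})$ is the set of $F$-minimal prime filters, i.e. the minimal elements (under inclusion) of the set of prime filters containing $F$. For a proper filter $H$, $D_F(H)=\{a\in A\mid x\vee a\in F\text{ for some }x\in A\setminus H\}$. The intersection of the empty family of subsets of $A$ is $A$. *)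

theory Defs
  imports Main
begin

text \<open>
  The carrier \<open>A\<close> is the universe of the type, \<open>\<odot>\<close> is \<open>*\<close>, and \<open>residuum x y\<close> is
  \<open>x \<rightarrow> y\<close>.  The lattice top and the monoid unit come from different library classes, so
  their identification has to be stated as an axiom.
\<close>

class residuated_lattice = bounded_lattice + comm_monoid_mult +
  fixes residuum :: "'a \<Rightarrow> 'a \<Rightarrow> 'a"
  assumes one_eq_top: "1 = top"
    and residuation: "x * y \<le> z \<longleftrightarrow> x \<le> residuum y z"

definition rl_filter :: "'a::residuated_lattice set \<Rightarrow> bool" where
  "rl_filter F \<longleftrightarrow> F \<noteq> {} \<and> (\<forall>x\<in>F. \<forall>y\<in>F. x * y \<in> F) \<and> (\<forall>x\<in>F. \<forall>y. sup x y \<in> F)"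

definition proper_filter :: "'a::residuated_lattice set \<Rightarrow> bool" where
  "proper_filter F \<longleftrightarrow> rl_filter F \<and> F \<noteq> UNIV"

definition prime_filter :: "'a::residuated_lattice set \<Rightarrow> bool" where
  "prime_filter P \<longleftrightarrow> proper_filter P \<and> (\<forall>x y. sup x y \<in> P \<longrightarrow> x \<in> P \<or> y \<in> P)"

definition minimal_primes :: "'a::residuated_lattice set \<Rightarrow> 'a set set" where
  "minimal_primes F =
    {\<mm>. prime_filter \<mm> \<and> F \<subseteq> \<mm> \<and> (\<forall>Q. prime_filter Q \<and> F \<subseteq> Q \<and> Q \<subseteq> \<mm> \<longrightarrow> Q = \<mm>)}"

text \<open>Only meaningful for proper filters \<open>H\<close>; the definition is total for convenience.\<close>

definition D :: "'a::residuated_lattice set \<Rightarrow> 'a set \<Rightarrow> 'a set" where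
  "D F H = {a. \<exists>x \<in> UNIV - H. sup x a \<in> F}"

end

theory Submission
  imports Defs
begin

text \<open>
  If \<open>x \<squnion> a \<in> F\<close> with \<open>x \<notin> P\<close>, then every prime \<open>\<mm>\<close> with \<open>F \<subseteq> \<mm> \<subseteq> P\<close> contains \<open>x \<squnion> a\<close> but not
  \<open>x\<close>, hence contains \<open>a\<close>.

  Conversely, let \<open>a \<notin> D F P\<close>.  The elements \<open>y \<le> x \<squnion> a\<close> with \<open>x \<notin> P\<close> form a set \<open>C\<close> which is
  closed under joins because \<open>P\<close> is prime, and \<open>a \<notin> D F P\<close> makes it disjoint from \<open>F\<close>.  It contains
  \<open>a\<close> and the complement of \<open>P\<close>, so a prime filter that separates \<open>F\<close> from \<open>C\<close>
  (\<open>prime_filter_separation\<close>) lies inside \<open>P\<close> and omits \<open>a\<close>.  A minimal prime over \<open>F\<close> below it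
  (\<open>minimal_prime_below\<close>) is a member of the intersection that omits \<open>a\<close>.

  When \<open>F\<close> is not contained in \<open>P\<close>, both sides are the whole algebra: any element of \<open>F\<close> outside
  \<open>P\<close> puts every \<open>a\<close> into \<open>D F P\<close>, and the intersection is over the empty family.  This case runs
  through the argument above without special treatment.
\<close>

lemma mult_le_left: "(x::'a::residuated_lattice) * y \<le> x"
proof -
  have "1 \<le> residuum x x"
    using residuation[of 1 x x] by simp
  then have "y \<le> residuum x x"
    by (metis one_eq_top top_greatest order_trans)
  then show ?thesis
    using residuation[of y x x] by (simp add: mult.commute)
qed

lemma sup_mult_le:
  fixes x y z w :: "'a::residuated_lattice"
  assumes "x * z \<le> w" "y * z \<le> w"
  shows "sup x y * z \<le> w"
  using assms residuation by (metis le_sup_iff)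

lemma sup_mult_sup_le:
  "sup u y * sup v y \<le> sup (u * v) (y::'a::residuated_lattice)"
proof (rule sup_mult_le)
  have "sup v y * u \<le> sup (u * v) y"
    by (rule sup_mult_le) (simp_all add: mult.commute[of v u] mult_le_left le_supI2)
  then show "u * sup v y \<le> sup (u * v) y"
    by (simp add: mult.commute)
  show "y * sup v y \<le> sup (u * v) y"
    by (simp add: mult_le_left le_supI2)
qed

lemma rl_filter_upward: "rl_filter F \<Longrightarrow> x \<in> F \<Longrightarrow> x \<le> y \<Longrightarrow> y \<in> F"
  unfolding rl_filter_def by (metis sup.absorb2)

text \<open>
  Multiplicative closure comes from \<open>(u \<squnion> y) \<odot> (v \<squnion> y) \<le> (u \<odot> v) \<squnion> y\<close>.  These filters take over
  the role of the filter generated by \<open>M\<close> and one further element in the separation theorem, and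
  spare a description of that filter by powers.
\<close>

lemma rl_filter_join_residual:
  assumes "rl_filter M"
  shows "rl_filter {u. sup u y \<in> M}"
proof -
  obtain m where "m \<in> M"
    using assms unfolding rl_filter_def by blast
  then have "sup m y \<in> M"
    using assms unfolding rl_filter_def by blast
  moreover have "sup (u * v) y \<in> M" if "sup u y \<in> M" "sup v y \<in> M" for u v
    using that assms sup_mult_sup_le rl_filter_upward unfolding rl_filter_def by blast
  moreover have "sup (sup u v) y \<in> M" if "sup u y \<in> M" for u v
    using rl_filter_upward[OF assms that] by (simp add: le_supI1)
  ultimately show ?thesis
    unfolding rl_filter_def by blast
qed

lemma rl_filter_Union_chain:
  assumes "\<C> \<noteq> {}" "\<And>G. G \<in> \<C> \<Longrightarrow> rl_filter G"
    and chain: "\<And>G H. G \<in> \<C> \<Longrightarrow> H \<in> \<C> \<Longrightarrow> G \<subseteq> H \<or> H \<subseteq> G"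
  shows "rl_filter (\<Union>\<C>)"
proof -
  have "\<Union>\<C> \<noteq> {}"
    using assms(1,2) unfolding rl_filter_def by blast
  moreover have "x * y \<in> \<Union>\<C>" if "x \<in> \<Union>\<C>" "y \<in> \<Union>\<C>" for x y
  proof -
    obtain G H where "G \<in> \<C>" "x \<in> G" "H \<in> \<C>" "y \<in> H"
      using \<open>x \<in> \<Union>\<C>\<close> \<open>y \<in> \<Union>\<C>\<close> by blast
    then show ?thesis
      using chain[of G H] assms(2)[of G] assms(2)[of H] unfolding rl_filter_def by blast
  qed
  moreover have "sup x y \<in> \<Union>\<C>" if "x \<in> \<Union>\<C>" for x y
    using that assms(2) unfolding rl_filter_def by blast
  ultimately show ?thesis
    unfolding rl_filter_def by blast
qed

text \<open>
  A filter \<open>M\<close> that is maximal among those disjoint from \<open>C\<close> is prime: were \<open>x \<squnion> y \<in> M\<close> with neither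
  \<open>x\<close> nor \<open>y\<close> in \<open>M\<close>, two enlargements of \<open>M\<close> by \<open>rl_filter_join_residual\<close> would replace first \<open>x\<close>
  and then \<open>y\<close> by elements of \<open>C\<close>, so that \<open>M\<close> would contain a join of two elements of \<open>C\<close>.
\<close>

theorem prime_filter_separation:
  fixes F C :: "'a::residuated_lattice set"
  assumes F: "rl_filter F" and "C \<noteq> {}"
    and join: "\<And>c d. c \<in> C \<Longrightarrow> d \<in> C \<Longrightarrow> sup c d \<in> C"
    and disj: "F \<inter> C = {}"
  obtains Q where "prime_filter Q" "F \<subseteq> Q" "Q \<inter> C = {}"
proof -
  define \<A> where "\<A> = {G. rl_filter G \<and> F \<subseteq> G \<and> G \<inter> C = {}}"
  have "\<Union>\<C> \<in> \<A>" if "\<C> \<noteq> {}" "subset.chain \<A> \<C>" for \<C>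
  proof -
    have sub: "\<C> \<subseteq> \<A>" and chain: "\<And>G H. G \<in> \<C> \<Longrightarrow> H \<in> \<C> \<Longrightarrow> G \<subseteq> H \<or> H \<subseteq> G"
      using that(2) unfolding subset_chain_def by blast+
    have "rl_filter (\<Union>\<C>)"
      using rl_filter_Union_chain[OF that(1)] sub chain unfolding \<A>_def by blast
    then show ?thesis
      using that(1) sub unfolding \<A>_def by blast
  qed
  moreover have "\<A> \<noteq> {}"
    using F disj unfolding \<A>_def by blast
  ultimately obtain M where "M \<in> \<A>" and max: "\<And>G. G \<in> \<A> \<Longrightarrow> M \<subseteq> G \<Longrightarrow> G = M"
    using subset_Zorn_nonempty[of \<A>] by blast
  then have M: "rl_filter M" "F \<subseteq> M" "M \<inter> C = {}"
    unfolding \<A>_def by blast+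
  have exchange: "\<exists>c\<in>C. sup c y \<in> M" if "sup x y \<in> M" "x \<notin> M" for x y
  proof (rule ccontr)
    assume none: "\<not> ?thesis"
    let ?G = "{u. sup u y \<in> M}"
    have "M \<subseteq> ?G"
      using M(1) unfolding rl_filter_def by blast
    moreover have "?G \<in> \<A>"
      using rl_filter_join_residual[OF M(1)] none M(2) \<open>M \<subseteq> ?G\<close> unfolding \<A>_def by blast
    ultimately have "?G = M"
      using max by blast
    then show False
      using that by blast
  qed
  have "x \<in> M \<or> y \<in> M" if "sup x y \<in> M" for x y
  proof (rule ccontr)
    assume notin: "\<not> ?thesis"
    then have "x \<notin> M" "y \<notin> M"
      by simp_all
    from exchange[OF that \<open>x \<notin> M\<close>] obtain c where c: "c \<in> C" "sup c y \<in> M"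
      by blast
    then have "sup y c \<in> M"
      by (simp add: sup_commute)
    from exchange[OF this \<open>y \<notin> M\<close>] obtain d where "d \<in> C" "sup d c \<in> M"
      by blast
    with c(1) have "sup d c \<in> M \<inter> C"
      using join by simp
    with M(3) show False
      by simp
  qed
  then have "prime_filter M"
    using M \<open>C \<noteq> {}\<close> unfolding prime_filter_def proper_filter_def by blast
  then show thesis
    using that M by blast
qed

text \<open>
  If \<open>x\<close> is missing from one member of the chain and \<open>y\<close> from another, both are missing from the
  smaller of the two, whose primality excludes \<open>x \<squnion> y\<close>.
\<close>

lemma prime_filter_Inter_chain:
  assumes "\<C> \<noteq> {}" and prime: "\<And>Q. Q \<in> \<C> \<Longrightarrow> prime_filter Q"
    and chain: "\<And>Q R. Q \<in> \<C> \<Longrightarrow> R \<in> \<C> \<Longrightarrow> Q \<subseteq> R \<or> R \<subseteq> Q"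
  shows "prime_filter (\<Inter>\<C>)"
proof -
  have filters: "rl_filter Q" if "Q \<in> \<C>" for Q
    using prime[OF that] unfolding prime_filter_def proper_filter_def by blast
  \<comment> \<open>The top element lies in every filter, so the intersection is not empty.\<close>
  have "top \<in> Q" if "Q \<in> \<C>" for Q
    using filters[OF that] rl_filter_upward[OF filters[OF that] _ top_greatest]
    unfolding rl_filter_def by blast
  then have "rl_filter (\<Inter>\<C>)"
    using filters unfolding rl_filter_def by blast
  moreover have "\<Inter>\<C> \<noteq> UNIV"
    using assms(1) prime unfolding prime_filter_def proper_filter_def by blast
  moreover have "x \<in> \<Inter>\<C> \<or> y \<in> \<Inter>\<C>" if "sup x y \<in> \<Inter>\<C>" for x y
  proof (rule ccontr)
    assume "\<not> ?thesis"
    then obtain Q where "Q \<in> \<C>" "x \<notin> Q" "y \<notin> Q"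
      using chain by blast
    then show False
      using that prime unfolding prime_filter_def by blast
  qed
  ultimately show ?thesis
    unfolding prime_filter_def proper_filter_def by blast
qed

lemma minimal_prime_below:
  assumes "prime_filter Q" "F \<subseteq> Q"
  obtains \<mm> where "\<mm> \<in> minimal_primes F" "\<mm> \<subseteq> Q"
proof -
  define \<B> where "\<B> = {R. prime_filter R \<and> F \<subseteq> R \<and> R \<subseteq> Q}"
  \<comment> \<open>Minimal primes are found as maximal complements.\<close>
  have "\<Union>\<C> \<in> uminus ` \<B>" if "\<C> \<noteq> {}" "subset.chain (uminus ` \<B>) \<C>" for \<C>
  proof -
    let ?\<D> = "uminus ` \<C>"
    have sub: "?\<D> \<subseteq> \<B>" and chain: "\<And>R S. R \<in> ?\<D> \<Longrightarrow> S \<in> ?\<D> \<Longrightarrow> R \<subseteq> S \<or> S \<subseteq> R"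
      using that(2) unfolding subset_chain_def by force+
    have "prime_filter (\<Inter>?\<D>)"
      by (rule prime_filter_Inter_chain) (use that(1) sub chain in \<open>auto simp: \<B>_def\<close>)
    then have "\<Inter>?\<D> \<in> \<B>"
      using that(1) sub unfolding \<B>_def by blast
    moreover have "\<Union>\<C> = - \<Inter>?\<D>"
      by auto
    ultimately show ?thesis
      by blast
  qed
  moreover have "uminus ` \<B> \<noteq> {}"
    using assms unfolding \<B>_def by blast
  ultimately obtain \<mm> where "\<mm> \<in> \<B>" and "\<forall>X\<in>uminus ` \<B>. - \<mm> \<subseteq> X \<longrightarrow> X = - \<mm>"
    using subset_Zorn_nonempty[of "uminus ` \<B>"] by blast
  then have min: "\<And>R. R \<in> \<B> \<Longrightarrow> R \<subseteq> \<mm> \<Longrightarrow> R = \<mm>"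
    by auto
  have "\<mm> \<in> minimal_primes F"
    using \<open>\<mm> \<in> \<B>\<close> min unfolding minimal_primes_def \<B>_def by blast
  then show thesis
    using that \<open>\<mm> \<in> \<B>\<close> unfolding \<B>_def by blast
qed

theorem corollary3p21:
  fixes F P :: "'a::residuated_lattice set"
  assumes "rl_filter F" and "prime_filter P"
  shows "D F P = \<Inter>{\<mm>. \<mm> \<in> minimal_primes F \<and> \<mm> \<subseteq> P}"
proof (intro equalityI subsetI)
  fix a
  assume "a \<in> D F P"
  then show "a \<in> \<Inter>{\<mm>. \<mm> \<in> minimal_primes F \<and> \<mm> \<subseteq> P}"
    unfolding D_def minimal_primes_def prime_filter_def by blast
next
  fix a
  assume a: "a \<in> \<Inter>{\<mm>. \<mm> \<in> minimal_primes F \<and> \<mm> \<subseteq> P}"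
  show "a \<in> D F P"
  proof (rule ccontr)
    assume "a \<notin> D F P"
    define C where "C = {y. \<exists>x. x \<notin> P \<and> y \<le> sup x a}"
    have disj: "F \<inter> C = {}"
      using \<open>a \<notin> D F P\<close> rl_filter_upward[OF assms(1)] unfolding C_def D_def by blast
    have join: "sup c d \<in> C" if "c \<in> C" "d \<in> C" for c d
    proof -
      from that obtain x y where xy: "x \<notin> P" "c \<le> sup x a" "y \<notin> P" "d \<le> sup y a"
        unfolding C_def by blast
      then have "sup x y \<notin> P"
        using assms(2) unfolding prime_filter_def by blast
      moreover have "sup c d \<le> sup (sup x y) a"
        using sup_mono[OF xy(2,4)] by (simp add: ac_simps)
      ultimately show ?thesis
        unfolding C_def by blast
    qed
    have "a \<in> C"
      using assms(2) unfolding C_def prime_filter_def proper_filter_def by auto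
    then have "C \<noteq> {}"
      by blast
    obtain Q where Q: "prime_filter Q" "F \<subseteq> Q" "Q \<inter> C = {}"
      by (rule prime_filter_separation[OF assms(1) \<open>C \<noteq> {}\<close> join disj])
    have "- P \<subseteq> C"
      unfolding C_def by auto
    then have "Q \<subseteq> P"
      using Q(3) by blast
    have "a \<notin> Q"
      using Q(3) \<open>a \<in> C\<close> by blast
    obtain \<mm> where "\<mm> \<in> minimal_primes F" "\<mm> \<subseteq> Q"
      by (rule minimal_prime_below[OF Q(1,2)])
    with a \<open>Q \<subseteq> P\<close> \<open>a \<notin> Q\<close> show False
      by blast
  qed
qed

end
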